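(* Let $C\subset\mathbb{R}^n$ be a semi-algebraic set and let $\bar{x}\in C$ be a fixed point. Let $C_1,\dots,C_m$ be the cells of a cylindrical algebraic decomposition of $C$, ordered so that their dimensions are non-decreasing. Define $\mathcal{N}_0=\mathbb{R}^n$ and, for $i=1,\dots,m$, $$\mathcal{N}_i=\mathcal{N}_{i-1}\cap\hat{N}_{C_i}(\bar{x}).$$ Then the final set $\mathcal{N}_m$ (the output of this iterative procedure) is equal to the regular normal cone of $C$ at $\bar{x}$: $$\mathcal{N}_m=\hat{N}_C(\bar{x}).$$
   Context: Throughout, $\langle\cdot,\cdot\rangle$ and $\|\cdot\|$ are the Euclidean inner product and norm on $\mathbb{R}^n$. Regular normal cone: for a set $A\subset\mathbb{R}^n$ (not necessarily closed) and a point $\bar{x}\in\mathbb{R}^n$, $\hat{N}_A(\bar{x})$ denotes the set of all $v^*\in\mathbb{R}^n$ such that for every $\epsilon>0$ there exists $\delta>0$ such that for all $x\in A\setminus\{\bar{x}\}$ with $\|x-\bar{x}\|^2\le\delta^2$, $$\langle v^*,x-\bar{x}\rangle^2\le\epsilon^2\|x-\bar{x}\|^2\quad\text{or}\quad\langle v^*,x-\bar{x}\rangle\le 0.$$ When $\bar{x}\in A$ this is the regular normal cone of $A$ at $\bar{x}$, i.e. the set of $v^*$ with $\langle v^*,x-\bar{x}\rangle\le o(\|x-\bar{x}\|)$ for $x\in A$. For the cells $C_i$ the same formula defines $\hat{N}_{C_i}(\bar{x})$, whether or not $\bar{x}$ belongs to $C_i$. A semi-algebraic set in $\mathbb{R}^n$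 is one defined by a finite Boolean combination of polynomial equations and inequalities. Cylindrical algebraic decomposition (CAD) of a semi-algebraic set $C\subset\mathbb{R}^n$: a finite collection of pairwise disjoint semi-algebraic sets (cells) $C_1,\dots,C_m$ with $C=\bigsqcup_{i=1}^m C_i$, arranged cylindrically with respect to a fixed ordering of the variables, meaning that for each $k<n$ the projections of any two cells onto the first $k$ coordinates are either identical or disjoint. *)

theory Defs
  imports "HOL-Analysis.Analysis"
begin

text \<open>
  On a Euclidean space, \<^const>\<open>real_polynomial_function\<close> holds of exactly the functions given by
  real polynomials in the coordinates.  The inequalities \<open>p \<ge> 0\<close>, \<open>p < 0\<close>, ... and unions
  are Boolean combinations of the generators.
\<close>

inductive semialgebraic :: "'a::euclidean_space set \<Rightarrow> bool" where
  sa_eq: "real_polynomial_function p \<Longrightarrow> semialgebraic {x. p x = 0}"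
| sa_pos: "real_polynomial_function p \<Longrightarrow> semialgebraic {x. p x > 0}"
| sa_compl: "semialgebraic A \<Longrightarrow> semialgebraic (- A)"
| sa_inter: "semialgebraic A \<Longrightarrow> semialgebraic B \<Longrightarrow> semialgebraic (A \<inter> B)"

definition semialgebraic_map_on ::
    "'a::euclidean_space set \<Rightarrow> ('a \<Rightarrow> 'b::euclidean_space) \<Rightarrow> bool" where
  "semialgebraic_map_on S f \<longleftrightarrow> semialgebraic ((\<lambda>x. (x, f x)) ` S)"

text \<open>A copy of \<open>(0,1)\<^sup>d\<close>, \<open>d = card I\<close>, in the coordinate subspace spanned by the axes in \<open>I\<close>.\<close>

definition open_cube :: "'n set \<Rightarrow> (real ^ 'n) set" where
  "open_cube I = {x. (\<forall>i\<in>I. 0 < x $ i \<and> x $ i < 1) \<and> (\<forall>i. i \<notin> I \<longrightarrow> x $ i = 0)}"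

text \<open>
  The dimension of a semi-algebraic set (Basu, Pollack, Roy, Algorithms in Real Algebraic
  Geometry, Section 5.3): the largest \<open>d\<close> such that there is an injective semi-algebraic map
  from \<open>(0,1)\<^sup>d\<close> into it, and -1 for the empty set.  Only \<open>d \<le> n\<close> can occur, so every cube
  needed is found inside the ambient space itself.
\<close>

definition semialgebraic_dim :: "(real ^ 'n) set \<Rightarrow> int" where
  "semialgebraic_dim A = Max (insert (- 1) ((\<lambda>I. int (card I)) `
     {I. \<exists>f :: real ^ 'n \<Rightarrow> real ^ 'n. semialgebraic_map_on (open_cube I) f \<and>
           inj_on f (open_cube I) \<and> f ` open_cube I \<subseteq> A}))"

text \<open>An ordering of the variables is an enumeration \<open>\<sigma> 0, ..., \<sigma> (n - 1)\<close> of the index type.\<close>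

definition variable_ordering :: "(nat \<Rightarrow> 'n::finite) \<Rightarrow> bool" where
  "variable_ordering \<sigma> \<longleftrightarrow> bij_betw \<sigma> {..<CARD('n)} UNIV"

definition proj_first :: "(nat \<Rightarrow> 'n::finite) \<Rightarrow> nat \<Rightarrow> real ^ 'n \<Rightarrow> (nat \<Rightarrow> real)" where
  "proj_first \<sigma> k x = restrict (\<lambda>j. x $ \<sigma> j) {..<k}"

definition cad ::
    "(nat \<Rightarrow> 'n::finite) \<Rightarrow> (real ^ 'n) set \<Rightarrow> nat \<Rightarrow> (nat \<Rightarrow> (real ^ 'n) set) \<Rightarrow> bool" where
  "cad \<sigma> C m D \<longleftrightarrow>
     (\<forall>i\<in>{1..m}. semialgebraic (D i)) \<and>
     disjoint_family_on D {1..m} \<and>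
     C = (\<Union>i\<in>{1..m}. D i) \<and>
     (\<forall>k<CARD('n). \<forall>i\<in>{1..m}. \<forall>j\<in>{1..m}.
        proj_first \<sigma> k ` D i = proj_first \<sigma> k ` D j \<or>
        proj_first \<sigma> k ` D i \<inter> proj_first \<sigma> k ` D j = {})"

text \<open>The base point need not belong to \<open>A\<close>.\<close>

definition regular_normal_cone :: "(real ^ 'n) set \<Rightarrow> real ^ 'n \<Rightarrow> (real ^ 'n) set" where
  "regular_normal_cone A xbar =
     {v. \<forall>\<epsilon>>0. \<exists>\<delta>>0. \<forall>x\<in>A - {xbar}. (norm (x - xbar))\<^sup>2 \<le> \<delta>\<^sup>2 \<longrightarrow>
           (v \<bullet> (x - xbar))\<^sup>2 \<le> \<epsilon>\<^sup>2 * (norm (x - xbar))\<^sup>2 \<or> v \<bullet> (x - xbar) \<le> 0}"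

primrec cone_iterate ::
    "(nat \<Rightarrow> (real ^ 'n) set) \<Rightarrow> real ^ 'n \<Rightarrow> nat \<Rightarrow> (real ^ 'n) set" where
  "cone_iterate D xbar 0 = UNIV"
| "cone_iterate D xbar (Suc i) = cone_iterate D xbar i \<inter> regular_normal_cone (D (Suc i)) xbar"

end

theory Submission
  imports Defs
begin

text \<open>Membership of \<open>v\<close> in the cone is, for each \<epsilon>, a condition imposed
  on every point of the set within some radius \<delta> of \<open>xbar\<close>. Finitely many radii
  have a positive minimum, so the cone of a finite union is the intersection of the cones
  (\<open>regular_normal_cone_Un\<close>). The cells cover \<open>C\<close>, so intersecting their
  cones one by one yields the cone of \<open>C\<close>.\<close>

lemma regular_normal_cone_empty: "regular_normal_cone {} xbar = UNIV"
  by (auto simp: regular_normal_cone_def intro: exI[of _ 1])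

lemma regular_normal_cone_mono:
  assumes "A \<subseteq> B"
  shows "regular_normal_cone B xbar \<subseteq> regular_normal_cone A xbar"
  using assms unfolding regular_normal_cone_def by fast

text \<open>For a given \<epsilon>, the smaller of the radii for \<open>A\<close> and
  \<open>B\<close> serves the union; the other inclusion is antitonicity in the set.\<close>

lemma regular_normal_cone_Un:
  "regular_normal_cone (A \<union> B) xbar = regular_normal_cone A xbar \<inter> regular_normal_cone B xbar"
proof (intro equalityI Int_greatest regular_normal_cone_mono Un_upper1 Un_upper2 subsetI)
  fix v assume v: "v \<in> regular_normal_cone A xbar \<inter> regular_normal_cone B xbar"
  \<comment> \<open>The pointwise condition is kept opaque: only the quantifiers and the radius
    matter.\<close>
  define P where "P \<epsilon> x \<longleftrightarrow>
    (v \<bullet> (x - xbar))\<^sup>2 \<le> \<epsilon>\<^sup>2 * (norm (x - xbar))\<^sup>2 \<or> v \<bullet> (x - xbar) \<le> 0" for \<epsilon> x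
  have cone: "v \<in> regular_normal_cone S xbar \<longleftrightarrow> (\<forall>\<epsilon>>0. \<exists>\<delta>>0. \<forall>x\<in>S - {xbar}.
      (norm (x - xbar))\<^sup>2 \<le> \<delta>\<^sup>2 \<longrightarrow> P \<epsilon> x)" for S
    unfolding regular_normal_cone_def P_def by simp
  have "\<exists>\<delta>>0. \<forall>x\<in>A \<union> B - {xbar}. (norm (x - xbar))\<^sup>2 \<le> \<delta>\<^sup>2 \<longrightarrow> P \<epsilon> x" if pos: "\<epsilon> > 0" for \<epsilon>
  proof -
    obtain a where "a > 0" and a: "\<forall>x\<in>A - {xbar}. (norm (x - xbar))\<^sup>2 \<le> a\<^sup>2 \<longrightarrow> P \<epsilon> x"
      using IntD1[OF v, unfolded cone, rule_format, OF pos] by auto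
    obtain b where "b > 0" and b: "\<forall>x\<in>B - {xbar}. (norm (x - xbar))\<^sup>2 \<le> b\<^sup>2 \<longrightarrow> P \<epsilon> x"
      using IntD2[OF v, unfolded cone, rule_format, OF pos] by auto
    \<comment> \<open>The definition compares squares, so positivity of \<open>a\<close> and
      \<open>b\<close> is needed to square the inequalities for \<open>min a b\<close>.\<close>
    have "(min a b)\<^sup>2 \<le> a\<^sup>2" "(min a b)\<^sup>2 \<le> b\<^sup>2"
      using \<open>a > 0\<close> \<open>b > 0\<close> by (auto intro!: power_mono)
    then have "\<forall>x\<in>A \<union> B - {xbar}. (norm (x - xbar))\<^sup>2 \<le> (min a b)\<^sup>2 \<longrightarrow> P \<epsilon> x"
      using a b by (auto dest: order_trans)
    moreover have "min a b > 0" using \<open>a > 0\<close> \<open>b > 0\<close> by simp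
    ultimately show ?thesis by blast
  qed
  then show "v \<in> regular_normal_cone (A \<union> B) xbar"
    unfolding cone by blast
qed

text \<open>Each iteration adds one set to the union. The start value \<open>UNIV\<close> is the
  cone of the empty union, as \<open>{1..0}\<close> is empty.\<close>

lemma cone_iterate_eq_regular_normal_cone_UN:
  "cone_iterate D xbar m = regular_normal_cone (\<Union>i\<in>{1..m}. D i) xbar"
proof (induction m)
  case 0
  show ?case by (simp add: regular_normal_cone_empty)
next
  case (Suc m)
  have "(\<Union>i\<in>{1..Suc m}. D i) = (\<Union>i\<in>{1..m}. D i) \<union> D (Suc m)"
    by (auto simp: atLeastAtMostSuc_conv)
  with Suc show ?case by (simp only: cone_iterate.simps regular_normal_cone_Un)
qed

theorem theorem3:
  fixes C :: "(real ^ 'n) set" and xbar :: "real ^ 'n"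
    and \<sigma> :: "nat \<Rightarrow> 'n" and m :: nat and D :: "nat \<Rightarrow> (real ^ 'n) set"
  assumes "semialgebraic C"
    and "xbar \<in> C"
    and "variable_ordering \<sigma>"
    and "cad \<sigma> C m D"
    and "mono_on {1..m} (\<lambda>i. semialgebraic_dim (D i))"
  shows "cone_iterate D xbar m = regular_normal_cone C xbar"
proof -
  have "C = (\<Union>i\<in>{1..m}. D i)"
    using \<open>cad \<sigma> C m D\<close> unfolding cad_def by blast
  then show ?thesis by (simp only: cone_iterate_eq_regular_normal_cone_UN)
qed

end
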